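(* For every integer $n \geq 373$, $p_{od}^{eu}(n) < p_{eu}^{od}(n)$.
   Context: A partition of a positive integer $n$ is a finite non-increasing sequence of positive integers (its parts) summing to $n$. Let $p_{od}^{eu}(n)$ denote the number of partitions of $n$ in which every even part is strictly larger than every odd part, even parts may be repeated arbitrarily, and odd parts are distinct. Let $p_{eu}^{od}(n)$ denote the number of partitions of $n$ in which every odd part is strictly larger than every even part, odd parts are distinct, and even parts may be repeated arbitrarily. In both cases, partitions with no even parts or with no odd parts are allowed. *)

theory Defs
  imports Main "HOL-Library.Multiset"
begin

definition partitions :: "nat \<Rightarrow> nat multiset set" where
  "partitions n = {M. (\<forall>x\<in>#M. 0 < x) \<and> sum_mset M = n}"

definition odd_parts_distinct :: "nat multiset \<Rightarrow> bool" where
  "odd_parts_distinct M = (\<forall>x. odd x \<longrightarrow> count M x \<le> 1)"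

definition p_od_eu :: "nat \<Rightarrow> nat" where
  "p_od_eu n = card {M \<in> partitions n. odd_parts_distinct M \<and>
      (\<forall>e\<in>#M. \<forall>d\<in>#M. even e \<longrightarrow> odd d \<longrightarrow> d < e)}"

definition p_eu_od :: "nat \<Rightarrow> nat" where
  "p_eu_od n = card {M \<in> partitions n. odd_parts_distinct M \<and>
      (\<forall>e\<in>#M. \<forall>d\<in>#M. even e \<longrightarrow> odd d \<longrightarrow> e < d)}"

end

(* Both counts are compared with the pairs (j, nu) such that j^2 plus twice the size of the
   partition nu is n.

   In a partition counted by p_eu_od, let j be the number of odd parts. Subtracting the staircase
   1, 3, ..., 2j-1 from them and halving all parts gives an arbitrary partition of (n - j^2)/2.

   In a partition counted by p_od_eu, let s be the number of odd parts. The odd parts are the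
   staircase 1, 3, ..., 2s-1 plus twice a partition with at most s parts, whose conjugate K has
   parts in 1..s; the halved even parts mu are at least s + |K|. The union of K and mu is again a
   partition of (n - s^2)/2, and K can be read off as its parts <= s, with two exceptions: s = 1
   with K nonempty, and K empty with s in mu. The union is a partition whose parts > s all
   are >= s + |K|, so all partitions that contain j+1 and at least two parts <= j are still free.
   The exceptional data are injected into this free space for j = 2 (n even) and for j = 3, 5
   (n odd). To make room for the parts that mark the image, the largest part is dissolved into
   ones; if it may be too small, the whole hook of the largest row and column is removed, which has
   at least 26 cells because the partition has size at least 182. This is where n >= 373 enters. *)

theory Submission
  imports Defs
begin

section \<open>Coding the partitions counted by p_od_eu\<close>

text \<open>
  The \<open>p\<close>-th largest element exceeds the corresponding staircase element by twice the
  \<open>p\<close>-th part of the conjugate of \<open>K\<close>.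
\<close>

definition odd_set :: "nat \<Rightarrow> nat multiset \<Rightarrow> nat set" where
  "odd_set s K = (\<lambda>p. 2 * (s - p + size {#x \<in># K. p \<le> x#}) + 1) ` {1..s}"

lemma odd_set_exists:
  assumes "finite S" "\<forall>x\<in>S. odd x"
  shows "\<exists>K. (\<forall>x\<in>#K. 1 \<le> x \<and> x \<le> card S) \<and> odd_set (card S) K = S \<and>
           \<Sum>S = (card S)\<^sup>2 + 2 * sum_mset K \<and> (S \<noteq> {} \<longrightarrow> Max S + 1 = 2 * (card S + size K))"
  using assms
proof (induction S rule: finite_linorder_max_induct)
  case empty
  show ?case by (rule exI[of _ "{#}"]) (simp add: odd_set_def)
next
  case (insert m S)
  let ?s = "card S"
  obtain K where K: "\<forall>x\<in>#K. 1 \<le> x \<and> x \<le> ?s" "odd_set ?s K = S"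
    "\<Sum>S = ?s\<^sup>2 + 2 * sum_mset K" "S \<noteq> {} \<longrightarrow> Max S + 1 = 2 * (?s + size K)"
    using insert by auto
  have mS: "m \<notin> S" using insert.hyps by auto
  obtain a where a: "m = 2 * a + 1" using insert.prems oddE by blast
  \<comment> \<open>The new row has length \<open>a - ?s\<close> and must be at least as long as the
    longest old row, of length \<open>size K\<close>; this is where \<open>m\<close> exceeding
    \<open>Max S\<close> enters.\<close>
  have "?s + size K \<le> a"
  proof (cases "S = {}")
    case True
    then have "K = {#}" using K(1) by (metis card.empty le_zero_eq multiset_nonemptyE not_one_le_zero)
    with True show ?thesis by simp
  next
    case False
    then have "Max S < m" "Max S + 1 = 2 * (?s + size K)" using insert.hyps K(4) by auto
    then have "2 * (?s + size K) < 2 * a + 2" using a by linarith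
    then show ?thesis by simp
  qed
  then obtain c where c: "a = ?s + size K + c" using le_Suc_ex by blast
  \<comment> \<open>Putting a row of length \<open>size K + c\<close> on top of the diagram
    lengthens each of its \<open>size K\<close> columns by one and creates \<open>c\<close> columns
    of height one; \<open>K\<close> lists the column heights.\<close>
  define L where "L = image_mset Suc K + replicate_mset c 1"
  have card: "card (insert m S) = Suc ?s" using mS insert.hyps by simp
  \<comment> \<open>The element at position \<open>q\<close> moves to position \<open>q + 1\<close>
    and keeps its value; the new columns of height one do not reach that far.\<close>
  have cnt: "size {#x \<in># L. Suc q \<le> x#} = size {#x \<in># K. q \<le> x#}" if "q \<ge> 1" for q
  proof -
    have "size {#x \<in># image_mset Suc K. Suc q \<le> x#} = size {#x \<in># K. q \<le> x#}" 
      by (simp add: filter_mset_image_mset)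
    moreover have "{#x \<in># replicate_mset c 1. Suc q \<le> x#} = {#}" 
      using that by (subst filter_mset_eq_conv) (auto split: if_splits)
    ultimately show ?thesis unfolding L_def by simp
  qed
  have all1: "{#x \<in># L. 1 \<le> x#} = L"
    by (subst filter_mset_eq_conv) (auto simp: L_def split: if_splits)
  have sz: "size L = size K + c" unfolding L_def by simp
  have "sum_mset (image_mset Suc K) = sum_mset K + size K"
    by (induction K) auto
  then have sm: "sum_mset L = sum_mset K + size K + c"
    unfolding L_def by simp
  have "{1..Suc ?s} = insert 1 (Suc ` {1..?s})"
    by (simp only: image_Suc_atLeastAtMost) (rule atLeastAtMost_insertL[symmetric], simp)
  then have "odd_set (Suc ?s) L = insert (2 * (?s + size L) + 1)
     ((\<lambda>q. 2 * (?s - q + size {#x \<in># L. Suc q \<le> x#}) + 1) ` {1..?s})"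
    unfolding odd_set_def
    by (simp only: image_insert image_image all1 diff_Suc_1 diff_Suc_Suc One_nat_def[symmetric])
  also have "\<dots> = insert m ((\<lambda>q. 2 * (?s - q + size {#x \<in># K. q \<le> x#}) + 1) ` {1..?s})"
  proof -
    have "2 * (?s + size L) + 1 = m" using sz a c by simp
    moreover have "(\<lambda>q. 2 * (?s - q + size {#x \<in># L. Suc q \<le> x#}) + 1) ` {1..?s} =
      (\<lambda>q. 2 * (?s - q + size {#x \<in># K. q \<le> x#}) + 1) ` {1..?s}"
      by (rule image_cong[OF refl]) (simp only: cnt atLeastAtMost_iff)
    ultimately show ?thesis by (simp only:)
  qed
  also have "\<dots> = insert m S" using K(2) unfolding odd_set_def by (simp only:)
  finally have e: "odd_set (Suc ?s) L = insert m S" .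
  have r: "\<forall>x\<in>#L. 1 \<le> x \<and> x \<le> Suc ?s"
    using K(1) unfolding L_def by (auto split: if_splits)
  have "\<Sum>(insert m S) = (Suc ?s)\<^sup>2 + 2 * sum_mset L"
    using insert.hyps mS K(3) sm a c by (simp add: power2_eq_square)
  moreover have "Max (insert m S) = m" 
    using insert.hyps by (intro Max_eqI) auto
  ultimately show ?case unfolding card
    by (intro exI[of _ L] conjI impI r e) (use sz a c in auto)
qed

text \<open>
  A triple \<open>(s, K, \<mu>)\<close> stands for the partition with odd parts \<open>odd_set s K\<close> and even parts
  \<open>2 * \<mu>\<close>; the bound on \<open>\<mu>\<close> says that twice its parts exceed \<open>Max (odd_set s K) = 2 * (s + size K) - 1\<close>.
\<close>

definition od_eu_data :: "nat \<Rightarrow> (nat \<times> nat multiset \<times> nat multiset) set" where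
  "od_eu_data n = {(s, K, \<mu>). (\<forall>x\<in>#K. 1 \<le> x \<and> x \<le> s) \<and>
     (\<forall>x\<in>#\<mu>. 0 < x \<and> (0 < s \<longrightarrow> s + size K \<le> x)) \<and> s\<^sup>2 + 2 * (sum_mset K + sum_mset \<mu>) = n}"

definition square_data :: "nat \<Rightarrow> (nat \<times> nat multiset) set" where
  "square_data n = {(j, \<nu>). (\<forall>x\<in>#\<nu>. 0 < x) \<and> j\<^sup>2 + 2 * sum_mset \<nu> = n}"

section \<open>Finiteness of the coding sets\<close>

lemma size_le_sum_mset: "(\<forall>x\<in>#M. 0 < x) \<Longrightarrow> size M \<le> sum_mset (M :: nat multiset)"
  by (induction M) auto

lemma finite_partitions_le: "finite {M :: nat multiset. (\<forall>x\<in>#M. 0 < x) \<and> sum_mset M \<le> n}"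
proof (rule finite_subset)
  show "{M :: nat multiset. (\<forall>x\<in>#M. 0 < x) \<and> sum_mset M \<le> n} \<subseteq>
    mset ` {xs. set xs \<subseteq> {..n} \<and> length xs \<le> n}"
  proof
    fix M :: "nat multiset" assume "M \<in> {M. (\<forall>x\<in>#M. 0 < x) \<and> sum_mset M \<le> n}"
    then have M: "\<forall>x\<in>#M. 0 < x" "sum_mset M \<le> n" by auto
    obtain xs where xs: "mset xs = M" using ex_mset by blast
    have "length xs \<le> n" using size_le_sum_mset[OF M(1)] M(2) xs by (metis le_trans size_mset)
    moreover have "set xs \<subseteq> {..n}"
    proof
      fix x assume "x \<in> set xs"
      then have "x \<le> sum_mset M" using xs by (metis set_mset_mset sum_mset.remove le_add1)
      then show "x \<in> {..n}" using M by simp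
    qed
    ultimately show "M \<in> mset ` {xs. set xs \<subseteq> {..n} \<and> length xs \<le> n}" using xs by blast
  qed
  show "finite (mset ` {xs. set xs \<subseteq> {..n} \<and> length xs \<le> n})"
    by (intro finite_imageI finite_lists_length_le) auto
qed

lemma le_square: "(s::nat) \<le> s\<^sup>2" by (simp add: power2_eq_square)

lemma finite_od_eu_data: "finite (od_eu_data n)"
proof (rule finite_subset)
  let ?P = "{M :: nat multiset. (\<forall>x\<in>#M. 0 < x) \<and> sum_mset M \<le> n}"
  show "od_eu_data n \<subseteq> {..n} \<times> ?P \<times> ?P"
  proof
    fix z assume z: "z \<in> od_eu_data n"
    obtain s K \<mu> where "z = (s, K, \<mu>)" by (cases z)
    with z show "z \<in> {..n} \<times> ?P \<times> ?P"
      unfolding od_eu_data_def using le_square[of s] by auto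
  qed
qed (use finite_partitions_le in auto)

lemma finite_square_data: "finite (square_data n)"
proof (rule finite_subset)
  let ?P = "{M :: nat multiset. (\<forall>x\<in>#M. 0 < x) \<and> sum_mset M \<le> n}"
  show "square_data n \<subseteq> {..n} \<times> ?P"
  proof
    fix z assume z: "z \<in> square_data n"
    obtain j \<nu> where "z = (j, \<nu>)" by (cases z)
    with z show "z \<in> {..n} \<times> ?P"
      unfolding square_data_def using le_square[of j] by auto
  qed
qed (use finite_partitions_le in auto)

lemma sum_mset_double: "sum_mset (image_mset ((*) 2) M) = 2 * sum_mset (M :: nat multiset)"
  by (induction M) auto

text \<open>For an upper bound it suffices that every counted partition is decoded from some triple:
  \<open>odd_set_exists\<close> codes the set of its odd parts, and halving its even parts gives
  \<open>\<mu>\<close>.\<close>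

lemma p_od_eu_le: "p_od_eu n \<le> card (od_eu_data n)"
proof -
  let ?A = "{M \<in> partitions n. odd_parts_distinct M \<and>
      (\<forall>e\<in>#M. \<forall>d\<in>#M. even e \<longrightarrow> odd d \<longrightarrow> d < e)}"
  let ?F = "\<lambda>(s, K, \<mu>). mset_set (odd_set s K) + image_mset ((*) 2) \<mu>"
  have "?A \<subseteq> ?F ` od_eu_data n"
  proof
    fix M assume "M \<in> ?A"
    then have pos: "\<forall>x\<in>#M. 0 < x" and sm: "sum_mset M = n" and dis: "\<forall>x. odd x \<longrightarrow> count M x \<le> 1"
      and sep: "\<And>e d. e \<in># M \<Longrightarrow> d \<in># M \<Longrightarrow> even e \<Longrightarrow> odd d \<Longrightarrow> d < e"
      by (auto simp: partitions_def odd_parts_distinct_def)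
    define S where "S = {x \<in> set_mset M. odd x}"
    define \<mu> where "\<mu> = image_mset (\<lambda>x. x div 2) {#x \<in># M. even x#}"
    have S: "finite S" "\<forall>x\<in>S. odd x" unfolding S_def by auto
    obtain K where K: "\<forall>x\<in>#K. 1 \<le> x \<and> x \<le> card S" "odd_set (card S) K = S"
      "\<Sum>S = (card S)\<^sup>2 + 2 * sum_mset K" "S \<noteq> {} \<longrightarrow> Max S + 1 = 2 * (card S + size K)"
      using odd_set_exists[OF S] by blast
    \<comment> \<open>Distinctness of the odd parts enters here: passing to the set \<open>S\<close>
      loses no multiplicity.\<close>
    have o: "{#x \<in># M. odd x#} = mset_set S"
    proof (rule multiset_eqI)
      fix x show "count {#x \<in># M. odd x#} x = count (mset_set S) x"
      proof (cases "x \<in> S")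
        case True
        then have "count M x > 0" "odd x" unfolding S_def by auto
        then have "count M x = 1" using dis[rule_format, of x] by linarith
        then show ?thesis using True S \<open>odd x\<close> by simp
      next
        case False
        then have "x \<notin># {#x \<in># M. odd x#}" unfolding S_def by auto
        then have "count {#x \<in># M. odd x#} x = 0" by (meson count_inI)
        moreover have "count (mset_set S) x = 0" using False by simp
        ultimately show ?thesis by (rule trans[OF _ sym])
      qed
    qed
    have e: "image_mset ((*) 2) \<mu> = {#x \<in># M. even x#}"
    proof -
      have "image_mset (\<lambda>x. 2 * (x div 2)) {#x \<in># M. even x#} = image_mset (\<lambda>x. x) {#x \<in># M. even x#}"
        by (rule image_mset_cong) auto
      then show ?thesis unfolding \<mu>_def by (simp add: multiset.map_comp comp_def)
    qed
    have M: "mset_set S + image_mset ((*) 2) \<mu> = M"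
      unfolding o[symmetric] e using multiset_partition[of M odd, symmetric] by simp
    have "sum_mset (mset_set S + image_mset ((*) 2) \<mu>) = \<Sum>S + 2 * sum_mset \<mu>"
      by (simp add: sum_unfold_sum_mset sum_mset_double)
    then have "n = \<Sum>S + 2 * sum_mset \<mu>"
      unfolding M sm .
    moreover have "0 < x \<and> (0 < card S \<longrightarrow> card S + size K \<le> x)" if x: "x \<in># \<mu>" for x
    proof
      have x2: "2 * x \<in># M" using x unfolding M[symmetric] by simp
      show "0 < x" using bspec[OF pos x2] by simp
      show "0 < card S \<longrightarrow> card S + size K \<le> x"
      proof
        assume "0 < card S"
        then have ne: "S \<noteq> {}" by auto
        then have "Max S \<in> S" using S by simp
        then have "Max S \<in># M" "odd (Max S)" unfolding S_def by blast+
        then have "Max S < 2 * x" using sep[OF x2] by simp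
        then show "card S + size K \<le> x" using K(4) ne by auto
      qed
    qed
    ultimately have "(card S, K, \<mu>) \<in> od_eu_data n"
      unfolding od_eu_data_def using K(1,3) by simp
    then have "?F (card S, K, \<mu>) \<in> ?F ` od_eu_data n" by (rule imageI)
    then show "M \<in> ?F ` od_eu_data n" using M K(2) by simp
  qed
  then show ?thesis unfolding p_od_eu_def
    by (rule surj_card_le[OF finite_od_eu_data])
qed

section \<open>Coding the partitions counted by p_eu_od\<close>

text \<open>
  If there are fewer than \<open>j\<close> parts, zeros make up for the missing ones: they become small odd parts.
\<close>

definition padded :: "nat \<Rightarrow> nat multiset \<Rightarrow> nat list" where
  "padded j \<nu> = replicate (j - size \<nu>) 0 @ sorted_list_of_multiset \<nu>"

text \<open>Padding and low parts never occur together: if \<open>j \<le> size \<nu>\<close>, no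
  zeros are added and the \<open>j\<close> largest parts are on top; otherwise
  \<open>size \<nu> - j\<close> is 0 and the whole padded list is on top.\<close>

definition low_parts :: "nat \<Rightarrow> nat multiset \<Rightarrow> nat list" where
  "low_parts j \<nu> = take (size \<nu> - j) (padded j \<nu>)"

definition top_parts :: "nat \<Rightarrow> nat multiset \<Rightarrow> nat list" where
  "top_parts j \<nu> = drop (size \<nu> - j) (padded j \<nu>)"

text \<open>Inverse of subtracting the staircase: counted from the smallest entry, position
  \<open>i\<close> regains \<open>2 * i + 1\<close>.\<close>

definition top_odd :: "nat list \<Rightarrow> nat list" where
  "top_odd xs = map (\<lambda>i. 2 * (xs ! i) + 2 * i + 1) [0..<length xs]"

lemma low_top: "low_parts j \<nu> @ top_parts j \<nu> = padded j \<nu>"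
  by (simp add: low_parts_def top_parts_def)

lemma sorted_padded: "sorted (padded j \<nu>)"
  by (auto simp: padded_def sorted_append)

lemma length_sorted_list_of_multiset: "length (sorted_list_of_multiset \<nu>) = size \<nu>"
  by (metis mset_sorted_list_of_multiset size_mset)

lemma length_top_parts: "length (top_parts j \<nu>) = j"
  by (simp add: top_parts_def padded_def length_sorted_list_of_multiset)

lemma mset_padded: "mset (padded j \<nu>) = replicate_mset (j - size \<nu>) 0 + \<nu>"
  by (simp add: padded_def)

lemma padded_inject:
  assumes "\<forall>x\<in>#\<nu>. 0 < x" "\<forall>x\<in>#\<nu>'. 0 < x" "padded j \<nu> = padded j \<nu>'"
  shows "\<nu> = \<nu>'"
proof -
  have *: "{#x \<in># mset (padded j \<rho>). 0 < x#} = \<rho>" if "\<forall>x\<in>#\<rho>. 0 < x" for \<rho>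
  proof -
    have "{#x \<in># replicate_mset k (0::nat). 0 < x#} = {#}" for k :: nat
      by (auto split: if_splits)
    moreover have "{#x \<in># \<rho>. 0 < x#} = \<rho>"
      using that by (subst filter_mset_eq_conv) auto
    ultimately show ?thesis unfolding mset_padded filter_union_mset by (simp only: add_0)
  qed
  have "\<nu> = {#x \<in># mset (padded j \<nu>). 0 < x#}" using *[OF assms(1)] by (rule sym)
  also have "\<dots> = \<nu>'" unfolding assms(3) by (rule *[OF assms(2)])
  finally show ?thesis .
qed

text \<open>Padding zeros occur only when \<open>low_parts\<close> is empty, so they become small
  odd parts and never an even part 0.\<close>

lemma low_parts_pos: "\<forall>x\<in>#\<nu>. 0 < x \<Longrightarrow> x \<in> set (low_parts j \<nu>) \<Longrightarrow> 0 < x"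
  unfolding low_parts_def padded_def
  by (cases "j \<le> size \<nu>") (auto dest!: in_set_takeD)

lemma low_le_top: "x \<in> set (low_parts j \<nu>) \<Longrightarrow> y \<in> set (top_parts j \<nu>) \<Longrightarrow> x \<le> y"
  using sorted_padded[of j \<nu>] unfolding low_top[symmetric] by (auto simp: sorted_append)

lemma sorted_top_parts: "sorted (top_parts j \<nu>)"
  unfolding top_parts_def by (rule sorted_wrt_drop[OF sorted_padded])

lemma sorted_low_parts: "sorted (low_parts j \<nu>)"
  unfolding low_parts_def by (rule sorted_wrt_take[OF sorted_padded])

lemma length_top_odd [simp]: "length (top_odd xs) = length xs"
  by (simp add: top_odd_def)

lemma nth_top_odd: "i < length xs \<Longrightarrow> top_odd xs ! i = 2 * (xs ! i) + 2 * i + 1"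
  by (simp add: top_odd_def)

text \<open>The strictly increasing staircase turns repeated entries into distinct odd
  parts.\<close>

lemma strict_sorted_top_odd: "sorted xs \<Longrightarrow> sorted_wrt (<) (top_odd xs)"
  unfolding sorted_wrt_iff_nth_less
proof (intro allI impI)
  fix i k assume "\<forall>i j. i < j \<longrightarrow> j < length xs \<longrightarrow> xs ! i \<le> xs ! j" "i < k" "k < length (top_odd xs)"
  then have "xs ! i \<le> xs ! k" by simp
  then show "top_odd xs ! i < top_odd xs ! k"
    using \<open>i < k\<close> \<open>k < length (top_odd xs)\<close> by (simp add: nth_top_odd)
qed

lemma sum_list_top_odd: "sum_list (top_odd xs) = 2 * sum_list xs + (length xs)\<^sup>2"
proof -
  have sq: "(\<Sum>i = 0..<n. 2 * i + 1) = n\<^sup>2" for n :: nat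
    by (induction n) (auto simp: power2_eq_square)
  have "sum_list (top_odd xs) = (\<Sum>i = 0..<length xs. 2 * (xs ! i) + (2 * i + 1))"
    by (simp add: sum_list_sum_nth nth_top_odd add.assoc)
  also have "\<dots> = (\<Sum>i = 0..<length xs. 2 * (xs ! i)) + (\<Sum>i = 0..<length xs. 2 * i + 1)"
    by (rule sum.distrib)
  also have "(\<Sum>i = 0..<length xs. 2 * (xs ! i)) = 2 * sum_list xs"
    by (simp add: sum_list_sum_nth sum_distrib_left)
  finally show ?thesis using sq by simp
qed

lemma top_odd_inject:
  assumes "top_odd xs = top_odd ys"
  shows "xs = ys"
proof -
  have l: "length xs = length ys" using assms by (metis length_top_odd)
  show ?thesis
  proof (rule nth_equalityI[OF l])
    fix i assume "i < length xs"
    then show "xs ! i = ys ! i" using nth_top_odd[of i xs] nth_top_odd[of i ys] l assms by simp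
  qed
qed

definition eu_od_of :: "nat \<times> nat multiset \<Rightarrow> nat multiset" where
  "eu_od_of = (\<lambda>(j, \<nu>). mset (map ((*) 2) (low_parts j \<nu>)) + mset (top_odd (top_parts j \<nu>)))"

lemma odd_top_odd: "x \<in> set (top_odd xs) \<Longrightarrow> odd x"
  by (auto simp: top_odd_def)

lemma eu_od_of_odd: "{#x \<in># eu_od_of (j, \<nu>). odd x#} = mset (top_odd (top_parts j \<nu>))"
  unfolding eu_od_of_def by (subst filter_mset_eq_conv) (auto dest: odd_top_odd)

lemma eu_od_of_even: "{#x \<in># eu_od_of (j, \<nu>). even x#} = mset (map ((*) 2) (low_parts j \<nu>))"
  unfolding eu_od_of_def by (subst filter_mset_eq_conv) (auto dest: odd_top_odd)

lemma sorted_mset_unique: "mset xs = mset ys \<Longrightarrow> sorted xs \<Longrightarrow> sorted ys \<Longrightarrow> xs = ys"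
  by (metis sorted_sort_id sorted_list_of_multiset_mset)

text \<open>Parity separates the two halves of the image, sorting restores both lists, and the
  number of odd parts is \<open>j\<close>; the padded list then determines
  \<open>\<nu>\<close>.\<close>

lemma eu_od_of_inj: "inj_on eu_od_of (square_data n)"
proof (rule inj_onI)
  fix z z' assume z: "z \<in> square_data n" "z' \<in> square_data n" and eq: "eu_od_of z = eu_od_of z'"
  obtain j \<nu> where jn: "z = (j, \<nu>)" by (cases z)
  obtain k \<rho> where kr: "z' = (k, \<rho>)" by (cases z')
  have pos: "\<forall>x\<in>#\<nu>. 0 < x" "\<forall>x\<in>#\<rho>. 0 < x" using z jn kr by (auto simp: square_data_def)
  have srt: "sorted (top_odd (top_parts i \<tau>))" for i \<tau>
    using strict_sorted_top_odd[OF sorted_top_parts] strict_sorted_imp_sorted by blast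
  have "mset (top_odd (top_parts j \<nu>)) = mset (top_odd (top_parts k \<rho>))"
    using eq jn kr eu_od_of_odd by metis
  then have "top_odd (top_parts j \<nu>) = top_odd (top_parts k \<rho>)"
    by (rule sorted_mset_unique) (rule srt)+
  then have top: "top_parts j \<nu> = top_parts k \<rho>" by (rule top_odd_inject)
  then have jk: "j = k" using length_top_parts by metis
  have srt2: "sorted (map ((*) 2) (low_parts i \<tau>))" for i \<tau>
    using sorted_low_parts[of i \<tau>] by (simp add: sorted_map sorted_wrt_iff_nth_less)
  have "mset (map ((*) 2) (low_parts j \<nu>)) = mset (map ((*) 2) (low_parts k \<rho>))"
    using eq jn kr eu_od_of_even by metis
  then have "map ((*) 2) (low_parts j \<nu>) = map ((*) 2) (low_parts k \<rho>)"
    by (rule sorted_mset_unique) (rule srt2)+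
  then have "low_parts j \<nu> = low_parts k \<rho>"
    by (rule map_injective) (simp add: inj_on_def)
  then have "padded j \<nu> = padded j \<rho>"
    using top jk low_top by metis
  then show "z = z'" using padded_inject[OF pos] jk jn kr by simp
qed

text \<open>A lower bound needs only an injection into the counted partitions. Odd parts exceed even
  ones because \<open>x \<le> y\<close> gives \<open>2 * x < 2 * y + 2 * i + 1\<close>.\<close>

lemma square_data_le: "card (square_data n) \<le> p_eu_od n"
proof -
  let ?B = "{M \<in> partitions n. odd_parts_distinct M \<and>
      (\<forall>e\<in>#M. \<forall>d\<in>#M. even e \<longrightarrow> odd d \<longrightarrow> e < d)}"
  have "eu_od_of ` square_data n \<subseteq> ?B"
  proof (rule image_subsetI)
    fix z assume z: "z \<in> square_data n"
    obtain j \<nu> where jn: "z = (j, \<nu>)" by (cases z)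
    let ?M = "eu_od_of (j, \<nu>)"
    have pos: "\<forall>x\<in>#\<nu>. 0 < x" and n: "j\<^sup>2 + 2 * sum_mset \<nu> = n"
      using z jn by (auto simp: square_data_def)
    have "sum_list (low_parts j \<nu>) + sum_list (top_parts j \<nu>) = sum_list (padded j \<nu>)"
      unfolding low_top[symmetric] by simp
    also have "\<dots> = sum_mset \<nu>" using mset_padded[of j \<nu>] by (simp flip: sum_mset_sum_list)
    finally have "sum_mset ?M = n" unfolding eu_od_of_def
      using n by (simp add: sum_mset_double sum_mset_sum_list sum_list_top_odd length_top_parts)
    moreover have "\<forall>x\<in>#?M. 0 < x"
      using low_parts_pos[OF pos, of _ j] unfolding eu_od_of_def by (auto dest: odd_top_odd intro: odd_pos)
    moreover have "odd_parts_distinct ?M" unfolding odd_parts_distinct_def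
    proof (intro allI impI)
      fix x :: nat assume "odd x"
      then have "count ?M x = count {#x \<in># ?M. odd x#} x" by simp
      also have "\<dots> \<le> 1" unfolding eu_od_of_odd
        using strict_sorted_iff[of "top_odd (top_parts j \<nu>)"] strict_sorted_top_odd[OF sorted_top_parts]
        by (simp add: distinct_count_atmost_1)
      finally show "count ?M x \<le> 1" .
    qed
    moreover have "e < d" if "e \<in># ?M" "d \<in># ?M" "even e" "odd d" for e d
    proof -
      have "e \<in># {#x \<in># ?M. even x#}" "d \<in># {#x \<in># ?M. odd x#}" using that by auto
      then obtain x where x: "x \<in> set (low_parts j \<nu>)" "e = 2 * x" and d: "d \<in> set (top_odd (top_parts j \<nu>))"
        unfolding eu_od_of_even eu_od_of_odd by auto
      from d obtain i where i: "i < j" "d = 2 * (top_parts j \<nu> ! i) + 2 * i + 1"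
        by (auto simp: top_odd_def length_top_parts)
      have "x \<le> top_parts j \<nu> ! i"
        using low_le_top[OF x(1)] i(1) length_top_parts by (metis nth_mem)
      then show "e < d" using x i by simp
    qed
    ultimately show "eu_od_of z \<in> ?B" unfolding jn partitions_def by blast
  qed
  moreover have "finite ?B"
    by (rule finite_subset[OF _ finite_partitions_le[of n]]) (auto simp: partitions_def)
  ultimately show ?thesis unfolding p_eu_od_def
    using card_inj_on_le[OF eu_od_of_inj] by blast
qed

section \<open>Injections into the irregular partitions\<close>

definition partitions_ge :: "nat \<Rightarrow> nat \<Rightarrow> nat multiset set" where
  "partitions_ge a m = {\<mu>. (\<forall>x\<in>#\<mu>. a \<le> x) \<and> sum_mset \<mu> = m}"

text \<open>Such a partition violates the gap condition of \<open>regular\<close> for every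
  \<open>j \<ge> 2\<close>. Only ones and twos count as small parts here; their numbers will also
  tell the images of the various injections apart.\<close>

definition irregular :: "nat \<Rightarrow> nat \<Rightarrow> nat multiset set" where
  "irregular j m = {\<nu> \<in> partitions_ge 1 m. j + 1 \<in># \<nu> \<and> 2 \<le> count \<nu> 1 + count \<nu> 2}"

text \<open>Room for the images of triples under
  \<open>(s, K, \<mu>) \<mapsto> (s, K + \<mu>)\<close>: the parts up to \<open>s\<close> play the
  role of \<open>K\<close>. For \<open>s \<le> 1\<close> no pair is left free.\<close>

definition regular :: "nat \<Rightarrow> (nat \<times> nat multiset) set" where
  "regular n = {(s, \<nu>). (s, \<nu>) \<in> square_data n \<and>
     (s \<le> 1 \<or> (\<forall>x\<in>#\<nu>. s < x \<longrightarrow> s + size {#y \<in># \<nu>. y \<le> s#} \<le> x))}"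

lemma finite_partitions_ge: "0 < a \<Longrightarrow> finite (partitions_ge a m)"
  by (rule finite_subset[OF _ finite_partitions_le[of m]]) (auto simp: partitions_ge_def)

lemma finite_irregular: "finite (irregular j m)"
  unfolding irregular_def by (simp add: finite_partitions_ge)

section \<open>Removing the hook of the largest row and column\<close>

definition remove_hook :: "nat multiset \<Rightarrow> nat multiset" where
  "remove_hook \<mu> = image_mset (\<lambda>x. x - 1) (\<mu> - {#Max_mset \<mu>#})"

lemma remove_Max_inject:
  assumes "\<mu> \<noteq> {#}" "\<nu> \<noteq> {#}" "sum_mset \<mu> = sum_mset \<nu>"
    and "\<mu> - {#Max_mset \<mu>#} = \<nu> - {#Max_mset \<nu> :: nat#}"
  shows "\<mu> = \<nu>"
proof -
  have *: "add_mset (Max_mset \<rho>) (\<rho> - {#Max_mset \<rho>#}) = \<rho>" if "\<rho> \<noteq> {#}" for \<rho> :: "nat multiset"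
    using that by simp
  have "sum_mset \<rho> = Max_mset \<rho> + sum_mset (\<rho> - {#Max_mset \<rho>#})" if "\<rho> \<noteq> {#}" for \<rho> :: "nat multiset"
    using arg_cong[OF *[OF that], of sum_mset] by simp
  then have "Max_mset \<mu> = Max_mset \<nu>" using assms by (metis add_right_cancel)
  then show ?thesis using assms * by metis
qed

text \<open>Raising every entry by one restores the column, because a part 1 leaves a zero behind;
  the known total then returns the largest part.\<close>

lemma remove_hook_inject:
  assumes "\<mu> \<noteq> {#}" "\<nu> \<noteq> {#}" "sum_mset \<mu> = sum_mset \<nu>" "\<forall>x\<in>#\<mu>. 0 < x" "\<forall>x\<in>#\<nu>. 0 < x"
    and "remove_hook \<mu> = remove_hook \<nu>"
  shows "\<mu> = \<nu>"
proof (rule remove_Max_inject)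
  have *: "image_mset Suc (remove_hook \<rho>) = \<rho> - {#Max_mset \<rho>#}" if "\<forall>x\<in>#\<rho>. 0 < x" for \<rho>
  proof -
    have "image_mset (\<lambda>x. Suc (x - 1)) (\<rho> - {#Max_mset \<rho>#}) = image_mset (\<lambda>x. x) (\<rho> - {#Max_mset \<rho>#})"
      by (rule image_mset_cong) (use that in \<open>auto dest: in_diffD\<close>)
    then show ?thesis unfolding remove_hook_def by (simp add: multiset.map_comp comp_def)
  qed
  show "\<mu> - {#Max_mset \<mu>#} = \<nu> - {#Max_mset \<nu>#}"
    using *[OF assms(4)] *[OF assms(5)] assms(6) by metis
qed fact+

text \<open>The hook has \<open>Max_mset \<mu> + size \<mu> - 1\<close> cells, the corner being
  shared by row and column.\<close>

lemma sum_remove_hook: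
  assumes "\<mu> \<noteq> {#}" "\<forall>x\<in>#\<mu>. 0 < x"
  shows "sum_mset (remove_hook \<mu>) + Max_mset \<mu> + size \<mu> = sum_mset \<mu> + 1"
proof -
  have *: "sum_mset (image_mset (\<lambda>x. x - 1) M) + size M = sum_mset M" if "\<forall>x\<in>#M. 0 < x" for M :: "nat multiset"
    using that by (induction M) auto
  let ?M = "\<mu> - {#Max_mset \<mu>#}"
  have m: "add_mset (Max_mset \<mu>) ?M = \<mu>" using assms(1) by simp
  have "sum_mset \<mu> = Max_mset \<mu> + sum_mset ?M" "size \<mu> = size ?M + 1"
    using arg_cong[OF m, of sum_mset] arg_cong[OF m, of size] by simp_all
  moreover have "sum_mset (remove_hook \<mu>) + size ?M = sum_mset ?M"
    unfolding remove_hook_def by (rule *) (use assms(2) in \<open>auto dest: in_diffD\<close>)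
  ultimately show ?thesis by simp
qed

lemma remove_hook_ge: "\<forall>x\<in>#\<mu>. Suc a \<le> x \<Longrightarrow> x \<in># remove_hook \<mu> \<Longrightarrow> a \<le> x"
  unfolding remove_hook_def by (fastforce dest: in_diffD)

lemma remove_hook_le: "x \<in># remove_hook \<mu> \<Longrightarrow> x \<le> Max_mset \<mu> - 1"
  unfolding remove_hook_def by (auto dest!: in_diffD intro: diff_le_mono)

lemma count_remove_hook: "count (remove_hook \<mu>) (Suc k) \<le> count \<mu> (Suc (Suc k))"
proof -
  have "count (image_mset (\<lambda>x. x - 1) M) (Suc k) = count M (Suc (Suc k))" for M
    by (induction M) auto
  then show ?thesis unfolding remove_hook_def by simp
qed

lemma sum_mset_le_size_Max: "sum_mset \<mu> \<le> size \<mu> * Max_mset (\<mu> :: nat multiset)"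
proof -
  have "sum_mset M \<le> size M * b" if "\<forall>x\<in>#M. x \<le> b" for M and b :: nat
    using that by (induction M) auto
  then show ?thesis by simp
qed

text \<open>The diagram fits into a rectangle with sides \<open>a\<close> and \<open>b\<close>, and
  \<open>4 * a * b \<le> (a + b)^2\<close> by the inequality of arithmetic and geometric
  means.\<close>

lemma Max_plus_size:
  assumes "k\<^sup>2 < 4 * sum_mset \<mu>"
  shows "k < Max_mset \<mu> + size (\<mu> :: nat multiset)"
proof -
  define a b where "a = Max_mset \<mu>" and "b = size \<mu>"
  have "4 * sum_mset \<mu> \<le> 4 * (b * a)" using sum_mset_le_size_Max[of \<mu>] a_def b_def by simp
  also have "4 * (b * a) \<le> (a + b)\<^sup>2"
  proof -
    have "int (4 * (b * a)) \<le> int ((a + b)\<^sup>2)"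
      using zero_le_power2[of "int a - int b"] by (simp add: power2_eq_square algebra_simps)
    then show ?thesis by linarith
  qed
  finally have "k\<^sup>2 < (a + b)\<^sup>2" using assms by simp
  then show ?thesis using a_def b_def power_less_imp_less_base by blast
qed

text \<open>Serves the injectivity proofs: marks smaller than all retained parts can be stripped off
  again.\<close>

lemma filter_ge_add_small:
  assumes "\<forall>x\<in>#M. a \<le> x" "\<forall>x\<in>#L. x < a"
  shows "{#x \<in># M + L. (a::nat) \<le> x#} = M"
  using assms by (subst filter_mset_eq_conv) force

text \<open>
  The size of \<open>\<mu>\<close> is fixed, so the removed hook need not be encoded: its cells are free to be
  used for the marks \<open>B\<close> and for ones, and \<open>remove_hook \<mu>\<close> determines \<open>\<mu>\<close>.
\<close>

lemma card_remove_hook_le: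
  assumes A: "A \<subseteq> partitions_ge 3 m" and m: "0 < m" "k\<^sup>2 < 4 * m"
    and B: "\<forall>x\<in>#B. 2 \<le> x" "m + sum_mset B + w \<le> M + k"
    and P: "\<And>\<mu>. \<mu> \<in> A \<Longrightarrow> P (remove_hook \<mu> + B)"
  shows "card A \<le>
    card {\<nu> \<in> partitions_ge 1 M. B \<subseteq># \<nu> \<and> w \<le> count \<nu> 1 \<and> P {#x \<in># \<nu>. 2 \<le> x#}}"
    (is "_ \<le> card ?R")
proof (rule card_inj_on_le)
  let ?f = "\<lambda>\<mu>. remove_hook \<mu> + B + replicate_mset (M - sum_mset B - sum_mset (remove_hook \<mu>)) 1"
  have ge: "\<forall>x\<in>#remove_hook \<mu> + B. 2 \<le> x" if "\<mu> \<in> A" for \<mu>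
    using that A B(1) remove_hook_ge[of \<mu> 2] by (auto simp: partitions_ge_def)
  have pos: "\<mu> \<noteq> {#}" "sum_mset \<mu> = m" "\<forall>x\<in>#\<mu>. 0 < x" if "\<mu> \<in> A" for \<mu>
    using that A m by (auto simp: partitions_ge_def dest!: subsetD)
  \<comment> \<open>Removing the hook leaves parts of size at least 2, so the ones in the image are
    exactly the filler.\<close>
  have filter: "{#x \<in># ?f \<rho>. 2 \<le> x#} = remove_hook \<rho> + B" if "\<rho> \<in> A" for \<rho>
    by (rule filter_ge_add_small) (use ge[OF that] in \<open>auto split: if_splits\<close>)
  show "inj_on ?f A"
  proof (rule inj_onI)
    fix \<mu> \<nu> assume A: "\<mu> \<in> A" "\<nu> \<in> A" and eq: "?f \<mu> = ?f \<nu>"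
    have "remove_hook \<mu> + B = remove_hook \<nu> + B"
      using filter[OF A(1)] filter[OF A(2)] eq by metis
    then show "\<mu> = \<nu>"
      using remove_hook_inject pos[OF A(1)] pos[OF A(2)] by simp
  qed
  show "?f ` A \<subseteq> ?R"
  proof (rule image_subsetI)
    fix \<mu> assume \<mu>: "\<mu> \<in> A"
    have h: "sum_mset (remove_hook \<mu>) + Max_mset \<mu> + size \<mu> = m + 1"
      using sum_remove_hook pos[OF \<mu>] by metis
    \<comment> \<open>The hook has at least \<open>k\<close> cells; by \<open>B(2)\<close> they pay
      for the marks, for \<open>w\<close> ones and for the change of the total from \<open>m\<close>
      to \<open>M\<close>.\<close>
    have "k < Max_mset \<mu> + size \<mu>" by (rule Max_plus_size) (use pos[OF \<mu>] m in simp)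
    with h B(2) have s: "sum_mset (remove_hook \<mu>) + sum_mset B + w \<le> M" by simp
    have "P {#x \<in># ?f \<mu>. 2 \<le> x#}" unfolding filter[OF \<mu>] by (rule P[OF \<mu>])
    moreover have "?f \<mu> \<in> partitions_ge 1 M"
    proof -
      have "\<forall>x\<in>#?f \<mu>. 1 \<le> x"
      proof
        fix x assume "x \<in># ?f \<mu>"
        then have "x \<in># remove_hook \<mu> + B \<or> x = 1" by (auto split: if_splits)
        then show "1 \<le> x" using bspec[OF ge[OF \<mu>], of x] by linarith
      qed
      moreover have "sum_mset (?f \<mu>) = M" using s by simp
      ultimately show ?thesis unfolding partitions_ge_def by blast
    qed
    moreover have "B \<subseteq># ?f \<mu>" by (simp add: subset_mset.add_increasing subset_mset.add_increasing2)
    moreover have "w \<le> count (?f \<mu>) 1" using s by simp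
    ultimately show "?f \<mu> \<in> ?R" by blast
  qed
  show "finite ?R" by (simp add: finite_partitions_ge)
qed

section \<open>Injections into the free space for odd \<open>n\<close>\<close>

lemma card_unique_smallest_le:
  assumes "186 \<le> N"
  shows "card {\<mu> \<in> partitions_ge 3 N. count \<mu> 3 \<le> 1} \<le>
    card {\<nu> \<in> irregular 3 (N - 4). 9 \<le> count \<nu> 1 \<and> count \<nu> 2 \<le> 1}"
    (is "card ?A \<le> card ?R")
proof -
  have "card ?A \<le> card {\<nu> \<in> partitions_ge 1 (N - 4). {#4#} \<subseteq># \<nu> \<and> 9 \<le> count \<nu> 1
      \<and> count {#x \<in># \<nu>. 2 \<le> x#} 2 \<le> 1}"
  \<comment> \<open>\<open>27^2 = 729\<close> is below \<open>4 * 186 = 744\<close>. The mark 4 is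
    the part \<open>j + 1\<close> for \<open>j = 3\<close>; nine ones keep the images apart from
    those with at most eight.\<close>
  proof (rule card_remove_hook_le[where k = 27 and m = N])
    fix \<mu> assume "\<mu> \<in> ?A"
    \<comment> \<open>Twos left by the removal come from threes, of which there is at most
      one.\<close>
    then show "count (remove_hook \<mu> + {#4#}) 2 \<le> 1"
      using count_remove_hook[of \<mu> 1] by (simp add: numeral_2_eq_2 numeral_3_eq_3)
  qed (use assms in auto)
  also have "\<dots> \<le> card ?R"
    by (rule card_mono, simp add: finite_irregular, auto simp: irregular_def)
  finally show ?thesis .
qed

text \<open>Serves \<open>s = 1\<close> with \<open>size K = 2\<close>. The marks 2, 2 set these
  images apart from the preceding ones, which have at most one two.\<close>

lemma card_partitions_ge_3_le:
  assumes "186 \<le> N"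
  shows "card (partitions_ge 3 (N - 2)) \<le>
    card {\<nu> \<in> irregular 3 (N - 4). 9 \<le> count \<nu> 1 \<and> 2 \<le> count \<nu> 2}" (is "_ \<le> card ?R")
proof -
  have "card (partitions_ge 3 (N - 2)) \<le> card {\<nu> \<in> partitions_ge 1 (N - 4).
      {#4, 2, 2#} \<subseteq># \<nu> \<and> 9 \<le> count \<nu> 1 \<and> True}"
    by (rule card_remove_hook_le[where k = 27 and m = "N - 2"]) (use assms in auto)
  also have "\<dots> \<le> card ?R"
  proof (rule card_mono)
    show "{\<nu> \<in> partitions_ge 1 (N - 4). {#4, 2, 2#} \<subseteq># \<nu> \<and> 9 \<le> count \<nu> 1 \<and> True} \<subseteq> ?R"
    proof
      fix \<nu> assume \<nu>: "\<nu> \<in> {\<nu> \<in> partitions_ge 1 (N - 4). {#4, 2, 2#} \<subseteq># \<nu> \<and> 9 \<le> count \<nu> 1 \<and> True}"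
      then have s: "{#4, 2, 2#} \<subseteq># \<nu>" by blast
      have "4 \<in># \<nu>" using mset_subset_eqD[OF s, of 4] by simp
      moreover have "2 \<le> count \<nu> 2" using mset_subset_eq_count[OF s, of 2] by simp
      ultimately show "\<nu> \<in> ?R" using \<nu> by (auto simp: irregular_def)
    qed
  qed (simp add: finite_irregular)
  finally show ?thesis .
qed

text \<open>Serves \<open>s = 3\<close> with \<open>K\<close> empty. The mark 6 belongs to
  \<open>j = 5\<close>, and five twos keep the images apart from those of
  \<open>card_few_twos_short_le\<close>.\<close>

lemma card_containing_3_le:
  assumes "186 \<le> N"
  shows "card {\<mu> \<in> partitions_ge 3 (N - 4). 3 \<in># \<mu>} \<le>
    card {\<nu> \<in> irregular 5 (N - 12). 5 \<le> count \<nu> 2}" (is "card ?A \<le> card ?R")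
proof -
  let ?B = "add_mset 6 (replicate_mset 5 2)"
  have "card ?A \<le> card {\<nu> \<in> partitions_ge 1 (N - 12). ?B \<subseteq># \<nu> \<and> 2 \<le> count \<nu> 1 \<and> True}"
    \<comment> \<open>\<open>N - 4\<close> may be 182, and \<open>4 * 182 = 728\<close> just misses
      \<open>27^2 = 729\<close>. The 26 cells pay exactly for marks of total 16, two ones and the
      drop by 8 from \<open>N - 4\<close> to \<open>N - 12\<close>.\<close>
    by (rule card_remove_hook_le[where k = 26 and m = "N - 4"]) (use assms in \<open>auto split: if_splits\<close>)
  also have "\<dots> \<le> card ?R"
  proof (rule card_mono)
    show "{\<nu> \<in> partitions_ge 1 (N - 12). ?B \<subseteq># \<nu> \<and> 2 \<le> count \<nu> 1 \<and> True} \<subseteq> ?R"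
    proof
      fix \<nu> assume \<nu>: "\<nu> \<in> {\<nu> \<in> partitions_ge 1 (N - 12). ?B \<subseteq># \<nu> \<and> 2 \<le> count \<nu> 1 \<and> True}"
      then have s: "?B \<subseteq># \<nu>" by blast
      have "6 \<in># \<nu>" using mset_subset_eqD[OF s, of 6] by simp
      moreover have "5 \<le> count \<nu> 2" using mset_subset_eq_count[OF s, of 2] by simp
      ultimately show "\<nu> \<in> ?R" using \<nu> by (auto simp: irregular_def)
    qed
  qed (simp add: finite_irregular)
  finally show ?thesis .
qed

text \<open>Serves \<open>s = 1\<close> with \<open>size K = 1\<close>, as do the next two lemmas.
  Five twos give way to \<open>4 + 1 + 1 + 1\<close>; as \<open>\<mu>\<close> has no ones, exactly
  three appear.\<close>

lemma card_many_twos_le: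
  assumes "186 \<le> N"
  shows "card {\<mu> \<in> partitions_ge 2 (N - 1). 5 \<le> count \<mu> 2} \<le>
    card {\<nu> \<in> irregular 3 (N - 4). count \<nu> 1 = 3}"
proof (rule card_inj_on_le)
  let ?A = "{\<mu> \<in> partitions_ge 2 (N - 1). 5 \<le> count \<mu> 2}"
  let ?T = "replicate_mset 5 (2::nat)" and ?B = "{#4, 1, 1, 1::nat#}"
  let ?f = "\<lambda>\<mu>. \<mu> - ?T + ?B"
  have T: "\<mu> - ?T + ?T = \<mu>" if "\<mu> \<in> ?A" for \<mu>
    using that by (intro subset_mset.diff_add) (simp add: count_le_replicate_mset_subset_eq[symmetric])
  show "inj_on ?f ?A"
  proof (rule inj_onI)
    fix \<mu> \<nu> assume A: "\<mu> \<in> ?A" "\<nu> \<in> ?A" and "?f \<mu> = ?f \<nu>"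
    then have "\<mu> - ?T = \<nu> - ?T" by simp
    then show "\<mu> = \<nu>" using T[OF A(1)] T[OF A(2)] by metis
  qed
  show "?f ` ?A \<subseteq> {\<nu> \<in> irregular 3 (N - 4). count \<nu> 1 = 3}"
  proof (rule image_subsetI)
    fix \<mu> assume A: "\<mu> \<in> ?A"
    have "sum_mset (\<mu> - ?T) + 10 = N - 1"
      using arg_cong[OF T[OF A], of sum_mset] A by (simp add: partitions_ge_def)
    moreover have ge: "\<forall>x\<in>#\<mu> - ?T. 2 \<le> x" using A by (auto simp: partitions_ge_def dest: in_diffD)
    moreover have "count (\<mu> - ?T) 1 = 0"
      using bspec[OF ge, of 1] by (meson count_inI not_one_le_zero numeral_le_one_iff semiring_norm(69))
    ultimately show "?f \<mu> \<in> {\<nu> \<in> irregular 3 (N - 4). count \<nu> 1 = 3}"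
      by (auto simp: irregular_def partitions_ge_def)
  qed
qed (simp add: finite_irregular)

text \<open>
  Here the ones already occur in \<open>remove_hook \<mu>\<close>, so the hook is turned into a single new part
  \<open>?Z \<mu>\<close>, which is recognised as the largest one.
\<close>

lemma card_few_twos_long_le:
  assumes "186 \<le> N"
  shows "card {\<mu> \<in> partitions_ge 2 (N - 1). count \<mu> 2 \<le> 4 \<and> 11 \<le> size \<mu>} \<le>
    card {\<nu> \<in> irregular 3 (N - 4). 4 \<le> count \<nu> 1 \<and> count \<nu> 1 \<le> 8}" (is "card ?A \<le> card ?R")
proof (rule card_inj_on_le)
  let ?Z = "\<lambda>\<mu>. N - 12 - sum_mset (remove_hook \<mu>)"
  let ?B = "{#4, 1, 1, 1, 1::nat#}"
  let ?f = "\<lambda>\<mu>. add_mset (?Z \<mu>) (remove_hook \<mu> + ?B)"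
  have pos: "\<mu> \<noteq> {#}" "sum_mset \<mu> = N - 1" "\<forall>x\<in>#\<mu>. 0 < x" "\<forall>x\<in>#remove_hook \<mu>. 1 \<le> x" if "\<mu> \<in> ?A" for \<mu>
    using that remove_hook_ge[of \<mu> 1] assms by (auto simp: partitions_ge_def numeral_2_eq_2)
  \<comment> \<open>\<open>?Z \<mu>\<close> is \<open>Max_mset \<mu> + size \<mu> - 12\<close>. With
    at least 11 parts this reaches \<open>Max_mset \<mu> - 1\<close>, which bounds the parts of
    \<open>remove_hook \<mu>\<close>; with \<open>Max_mset \<mu> + size \<mu> \<ge> 28\<close> it
    also exceeds the mark 4.\<close>
  have Z: "16 \<le> ?Z \<mu>" "Max_mset \<mu> - 1 \<le> ?Z \<mu>" "sum_mset (remove_hook \<mu>) + 12 \<le> N" if "\<mu> \<in> ?A" for \<mu>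
  proof -
    have h: "sum_mset (remove_hook \<mu>) + Max_mset \<mu> + size \<mu> = N"
      using sum_remove_hook[of \<mu>] pos[OF that] assms by simp
    have "27 < Max_mset \<mu> + size \<mu>" by (rule Max_plus_size) (use pos[OF that] assms in simp)
    with h that show "16 \<le> ?Z \<mu>" "Max_mset \<mu> - 1 \<le> ?Z \<mu>" "sum_mset (remove_hook \<mu>) + 12 \<le> N"
      by auto
  qed
  have Max: "Max_mset (?f \<mu>) = ?Z \<mu>" if A: "\<mu> \<in> ?A" for \<mu>
    by (rule Max_eqI) (use Z[OF A] remove_hook_le[of _ \<mu>] in \<open>force+\<close>)
  show "inj_on ?f ?A"
  proof (rule inj_onI)
    fix \<mu> \<nu> assume A: "\<mu> \<in> ?A" "\<nu> \<in> ?A" and eq: "?f \<mu> = ?f \<nu>"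
    have "?Z \<mu> = ?Z \<nu>"
      using Max[OF A(1)] Max[OF A(2)] arg_cong[OF eq, of Max_mset] by (metis (no_types))
    with eq have "remove_hook \<mu> = remove_hook \<nu>" by simp
    then show "\<mu> = \<nu>"
      using remove_hook_inject pos[OF A(1)] pos[OF A(2)] by simp
  qed
  show "?f ` ?A \<subseteq> ?R"
  proof (rule image_subsetI)
    fix \<mu> assume A: "\<mu> \<in> ?A"
    \<comment> \<open>Ones left by the removal come from twos; with the four marks this makes
      between four and eight.\<close>
    have "count (remove_hook \<mu>) 1 \<le> 4"
      using count_remove_hook[of \<mu> 0] A by (simp add: numeral_2_eq_2)
    then show "?f \<mu> \<in> ?R"
      using Z[OF A] pos(4)[OF A] by (auto simp: irregular_def partitions_ge_def)
  qed
qed (simp add: finite_irregular)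

text \<open>A total of at least 185 in at most ten parts forces a part of at least 19. It gives way
  to 6 and \<open>Max_mset \<mu> - 17\<close> ones, at least two of them.\<close>

lemma card_few_twos_short_le:
  assumes "186 \<le> N"
  shows "card {\<mu> \<in> partitions_ge 2 (N - 1). count \<mu> 2 \<le> 4 \<and> size \<mu> \<le> 10} \<le>
    card {\<nu> \<in> irregular 5 (N - 12). count \<nu> 2 \<le> 4}" (is "card ?A \<le> card ?R")
proof (rule card_inj_on_le)
  let ?M = "\<lambda>\<mu>. \<mu> - {#Max_mset \<mu>#}"
  let ?f = "\<lambda>\<mu>. (?M \<mu> + {#6#}) + replicate_mset (Max_mset \<mu> - 17) 1"
  have pos: "\<mu> \<noteq> {#}" "sum_mset \<mu> = N - 1" "\<forall>x\<in>#?M \<mu>. 2 \<le> x" if "\<mu> \<in> ?A" for \<mu>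
    using that assms by (auto simp: partitions_ge_def dest: in_diffD)
  show "inj_on ?f ?A"
  proof (rule inj_onI)
    fix \<mu> \<nu> assume A: "\<mu> \<in> ?A" "\<nu> \<in> ?A" and eq: "?f \<mu> = ?f \<nu>"
    have *: "{#x \<in># ?f \<rho>. 2 \<le> x#} = ?M \<rho> + {#6#}" if "\<rho> \<in> ?A" for \<rho>
      by (rule filter_ge_add_small) (use pos[OF that] in \<open>auto split: if_splits\<close>)
    have "?M \<mu> + {#6#} = ?M \<nu> + {#6#}" using *[OF A(1)] *[OF A(2)] eq by metis
    then show "\<mu> = \<nu>"
      using remove_Max_inject pos[OF A(1)] pos[OF A(2)] by simp
  qed
  show "?f ` ?A \<subseteq> ?R"
  proof (rule image_subsetI)
    fix \<mu> assume A: "\<mu> \<in> ?A"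
    have "N - 1 \<le> 10 * Max_mset \<mu>"
    proof -
      have "N - 1 \<le> size \<mu> * Max_mset \<mu>" using sum_mset_le_size_Max[of \<mu>] pos(2)[OF A] by simp
      also have "\<dots> \<le> 10 * Max_mset \<mu>" by (rule mult_le_mono1) (use A in simp)
      finally show ?thesis .
    qed
    then have M: "19 \<le> Max_mset \<mu>" using assms by simp
    define y R where "y = Max_mset \<mu>" and "R = ?M \<mu>"
    have m: "add_mset y R = \<mu>" using pos[OF A] by (simp add: y_def R_def)
    have y: "19 \<le> y" using M y_def by simp
    have sm: "sum_mset R + y = N - 1" using arg_cong[OF m, of sum_mset] pos(2)[OF A] by simp
    have R: "\<forall>x\<in>#R. 2 \<le> x" using pos(3)[OF A] R_def by simp
    then have "1 \<notin># R" by auto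
    then have c1: "count R 1 = 0" by (simp only: not_in_iff)
    have c2: "count R 2 \<le> 4"
    proof -
      have "count R 2 \<le> count \<mu> 2" unfolding m[symmetric] by simp
      then show ?thesis using A by simp
    qed
    have "\<forall>x\<in>#R + {#6#} + replicate_mset (y - 17) 1. 1 \<le> x"
    proof
      fix x assume "x \<in># R + {#6#} + replicate_mset (y - 17) 1"
      then have "x \<in># R \<or> x = 6 \<or> x = 1" by (auto split: if_splits)
      then show "1 \<le> x" using bspec[OF R, of x] by linarith
    qed
    moreover have "sum_mset (R + {#6#} + replicate_mset (y - 17) 1) = N - 12" using sm y by simp
    ultimately show "?f \<mu> \<in> ?R"
      unfolding R_def[symmetric] unfolding y_def[symmetric] irregular_def partitions_ge_def
      using c1 c2 y by simp
  qed
qed (simp add: finite_irregular)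

section \<open>The exceptional data\<close>

text \<open>For \<open>s = 1\<close> the triples with \<open>K\<close> empty already reach every
  pair \<open>(1, \<nu>)\<close> in \<open>square_data n\<close>, so those with \<open>K\<close>
  nonempty are exceptional.\<close>

definition od_eu_regular :: "nat \<Rightarrow> (nat \<times> nat multiset \<times> nat multiset) set" where
  "od_eu_regular n = {(s, K, \<mu>). (s, K, \<mu>) \<in> od_eu_data n \<and>
     (s \<le> 1 \<and> K = {#} \<or> 2 \<le> s \<and> (K \<noteq> {#} \<or> s \<notin># \<mu>))}"

text \<open>The union loses nothing: for \<open>s \<ge> 2\<close> all parts of \<open>\<mu>\<close>
  exceed \<open>s\<close>, so \<open>K\<close> consists of the parts up to \<open>s\<close>; for
  \<open>s \<le> 1\<close> it is empty.\<close>

lemma card_od_eu_regular_le: "card (od_eu_regular n) \<le> card (regular n)"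
proof (rule card_inj_on_le)
  let ?f = "\<lambda>(s, K, \<mu>). (s, K + \<mu>)"
  have gt: "s < x" if "(s, K, \<mu>) \<in> od_eu_regular n" "2 \<le> s" "x \<in># \<mu>" for s K \<mu> x
  proof (cases "K = {#}")
    case True
    then show ?thesis using that by (auto simp: od_eu_regular_def od_eu_data_def le_less)
  next
    case False
    then have "0 < size K" by (simp add: nonempty_has_size)
    moreover have "s + size K \<le> x" using that by (auto simp: od_eu_regular_def od_eu_data_def)
    ultimately show ?thesis by simp
  qed
  have K: "{#y \<in># K + \<mu>. y \<le> s#} = K" if "(s, K, \<mu>) \<in> od_eu_regular n" "2 \<le> s" for s K \<mu>
  proof -
    have "\<forall>x\<in>#K. x \<le> s" using that by (auto simp: od_eu_regular_def od_eu_data_def)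
    moreover have "\<forall>x\<in>#\<mu>. \<not> x \<le> s" using gt[OF that] by force
    ultimately show ?thesis by (subst filter_mset_eq_conv) auto
  qed
  show "inj_on ?f (od_eu_regular n)"
  proof (rule inj_onI)
    fix z z' assume z: "z \<in> od_eu_regular n" "z' \<in> od_eu_regular n" and eq: "?f z = ?f z'"
    obtain s K \<mu> where 1: "z = (s, K, \<mu>)" by (cases z)
    obtain s' K' \<mu>' where 2: "z' = (s', K', \<mu>')" by (cases z')
    have s: "s' = s" and KM: "K + \<mu> = K' + \<mu>'" using eq 1 2 by auto
    have "K = K'"
    proof (cases "2 \<le> s")
      case True
      then show ?thesis using K[of s K \<mu>] K[of s K' \<mu>'] z 1 2 s KM by simp
    next
      case False
      then show ?thesis using z 1 2 s by (auto simp: od_eu_regular_def)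
    qed
    then show "z = z'" using 1 2 s KM by simp
  qed
  show "?f ` od_eu_regular n \<subseteq> regular n"
  proof (rule image_subsetI)
    fix z assume z: "z \<in> od_eu_regular n"
    obtain s K \<mu> where 1: "z = (s, K, \<mu>)" by (cases z)
    have d: "\<forall>x\<in>#K. 1 \<le> x \<and> x \<le> s" "\<forall>x\<in>#\<mu>. 0 < x \<and> (0 < s \<longrightarrow> s + size K \<le> x)"
      "s\<^sup>2 + 2 * (sum_mset K + sum_mset \<mu>) = n"
      using z 1 by (auto simp: od_eu_regular_def od_eu_data_def)
    have "(s, K + \<mu>) \<in> square_data n" using d by (auto simp: square_data_def)
    moreover have "s + size {#y \<in># K + \<mu>. y \<le> s#} \<le> x" if "2 \<le> s" "x \<in># K + \<mu>" "s < x" for x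
      using K[of s K \<mu>] z 1 that d by auto
    ultimately show "?f z \<in> regular n" unfolding 1 regular_def by auto
  qed
  show "finite (regular n)"
    by (rule finite_subset[OF _ finite_square_data[of n]]) (auto simp: regular_def)
qed

lemma count_le_size_filter: "2 \<le> (j::nat) \<Longrightarrow> count \<nu> 1 + count \<nu> 2 \<le> size {#x \<in># \<nu>. x \<le> j#}"
  by (induction \<nu>) auto

text \<open>Two parts up to \<open>j\<close> push all larger parts of a regular partition to at
  least \<open>j + 2\<close>.\<close>

lemma regular_irregular_disjoint:
  assumes "2 \<le> j" "(j, \<nu>) \<in> regular n" "\<nu> \<in> irregular j m"
  shows False
proof -
  have "2 \<le> size {#x \<in># \<nu>. x \<le> j#}"
    using count_le_size_filter[OF assms(1), of \<nu>] assms(3) by (simp add: irregular_def)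
  moreover have "j + size {#y \<in># \<nu>. y \<le> j#} \<le> j + 1"
    using assms by (simp add: regular_def irregular_def)
  ultimately show False by simp
qed

lemma irregular_square_data: "\<nu> \<in> irregular j m \<Longrightarrow> j\<^sup>2 + 2 * m = n \<Longrightarrow> (j, \<nu>) \<in> square_data n"
  by (auto simp: irregular_def square_data_def partitions_ge_def)

section \<open>The exceptional data with \<open>s = 1\<close>\<close>

lemma one_data:
  assumes "(1, K, \<mu>) \<in> od_eu_data (2 * N + 1)"
  shows "replicate_mset (size K) 1 = K" "size K + sum_mset \<mu> = N" "\<forall>x\<in>#\<mu>. size K + 1 \<le> x"
proof -
  have "set_mset K \<subseteq> {1}" using assms by (auto simp: od_eu_data_def)
  then show K: "replicate_mset (size K) 1 = K" by (rule set_mset_subset_singletonD[symmetric])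
  have "sum_mset K = size K" using arg_cong[OF K, of sum_mset] by simp
  then show "size K + sum_mset \<mu> = N" "\<forall>x\<in>#\<mu>. size K + 1 \<le> x"
    using assms unfolding od_eu_data_def by simp_all
qed

lemma card_one_data_size_le:
  "card {z \<in> od_eu_data (2 * N + 1). fst z = 1 \<and> size (fst (snd z)) = c} \<le> card (partitions_ge (c + 1) (N - c))"
proof (rule card_inj_on_le)
  let ?A = "{z \<in> od_eu_data (2 * N + 1). fst z = 1 \<and> size (fst (snd z)) = c}"
  show "inj_on (\<lambda>z. snd (snd z)) ?A"
  proof (rule inj_onI)
    fix z z' assume z: "z \<in> ?A" "z' \<in> ?A" and eq: "snd (snd z) = snd (snd z')"
    have "replicate_mset c 1 = fst (snd w)" if "w \<in> ?A" for w
      using one_data(1)[of "fst (snd w)" "snd (snd w)" N] that by (cases w) auto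
    from this[OF z(1)] this[OF z(2)] have "fst (snd z) = fst (snd z')" by (rule trans[OF sym])
    then show "z = z'" using z eq by (simp add: prod_eq_iff)
  qed
  show "(\<lambda>z. snd (snd z)) ` ?A \<subseteq> partitions_ge (c + 1) (N - c)"
  proof (rule image_subsetI)
    fix z assume "z \<in> ?A"
    then show "snd (snd z) \<in> partitions_ge (c + 1) (N - c)"
      using one_data(2,3)[of "fst (snd z)" "snd (snd z)" N]
      by (cases z) (auto simp: partitions_ge_def)
  qed
qed (simp add: finite_partitions_ge)

text \<open>All sizes from 3 on are treated at once: \<open>size K\<close> joins
  \<open>\<mu>\<close> as its strictly smallest part and can be read off as such. A part 3 can only
  be this one.\<close>

lemma card_one_data_large_le:
  "card {z \<in> od_eu_data (2 * N + 1). fst z = 1 \<and> 3 \<le> size (fst (snd z))} \<le>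
    card {\<mu> \<in> partitions_ge 3 N. count \<mu> 3 \<le> 1}"
proof (rule card_inj_on_le)
  let ?A = "{z \<in> od_eu_data (2 * N + 1). fst z = 1 \<and> 3 \<le> size (fst (snd z))}"
  let ?f = "\<lambda>z. add_mset (size (fst (snd z))) (snd (snd z))"
  have A: "fst z = 1" "3 \<le> size (fst (snd z))" "replicate_mset (size (fst (snd z))) 1 = fst (snd z)"
    "size (fst (snd z)) + sum_mset (snd (snd z)) = N" "\<forall>x\<in>#snd (snd z). size (fst (snd z)) + 1 \<le> x"
    if "z \<in> ?A" for z
    using that one_data[of "fst (snd z)" "snd (snd z)" N] by (cases z; auto)+
  show "inj_on ?f ?A"
  proof (rule inj_onI)
    fix z z' assume z: "z \<in> ?A" "z' \<in> ?A" and eq: "?f z = ?f z'"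
    have "size (fst (snd w)) \<le> size (fst (snd w'))" if w: "w \<in> ?A" "w' \<in> ?A" "?f w = ?f w'" for w w'
    proof -
      have "size (fst (snd w')) \<in># ?f w" unfolding w(3) by simp
      then show ?thesis using A(5)[OF w(1)] by fastforce
    qed
    from this[OF z eq] this[OF z(2) z(1) eq[symmetric]]
    have s: "size (fst (snd z)) = size (fst (snd z'))" by simp
    then have "snd (snd z) = snd (snd z')" using eq by simp
    moreover have "fst (snd z) = fst (snd z')" using A(3)[OF z(1)] A(3)[OF z(2)] s by metis
    ultimately show "z = z'" using A(1)[OF z(1)] A(1)[OF z(2)] by (simp add: prod_eq_iff)
  qed
  show "?f ` ?A \<subseteq> {\<mu> \<in> partitions_ge 3 N. count \<mu> 3 \<le> 1}"
  proof (rule image_subsetI)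
    fix z assume z: "z \<in> ?A"
    have "3 \<notin># snd (snd z)" using A(2)[OF z] A(5)[OF z] by fastforce
    then have "count (snd (snd z)) 3 = 0" by (simp only: not_in_iff)
    moreover have "\<forall>x\<in>#snd (snd z). 3 \<le> x" using A(2)[OF z] A(5)[OF z] by fastforce
    ultimately show "?f z \<in> {\<mu> \<in> partitions_ge 3 N. count \<mu> 3 \<le> 1}"
      using A(2,4)[OF z] by (simp add: partitions_ge_def)
  qed
qed (simp add: finite_partitions_ge)

section \<open>The exceptional data with \<open>K\<close> empty and \<open>s\<close> in
  \<open>\<mu>\<close>\<close>

lemma card_three_data_le:
  "card {z \<in> od_eu_data (2 * N + 1). fst z = 3 \<and> fst (snd z) = {#} \<and> 3 \<in># snd (snd z)} \<le>
    card {\<mu> \<in> partitions_ge 3 (N - 4). 3 \<in># \<mu>}" (is "card ?A \<le> card ?R")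
proof (rule card_inj_on_le)
  show "inj_on (\<lambda>z. snd (snd z)) ?A" by (auto simp: inj_on_def prod_eq_iff)
  show "(\<lambda>z. snd (snd z)) ` ?A \<subseteq> ?R" by (auto simp: od_eu_data_def partitions_ge_def)
qed (simp add: finite_partitions_ge)

lemma remove1_sum_mset: "s \<in># \<mu> \<Longrightarrow> sum_mset (\<mu> - {#s#}) + s = sum_mset (\<mu> :: nat multiset)"
  by (simp add: sum_mset.remove)

text \<open>With \<open>R\<close> the common rest, \<open>s^2 + 2 * s + 2 * sum_mset R = n\<close>,
  which fixes \<open>(s + 1)^2\<close>.\<close>

lemma staircase_inject:
  assumes "(s, {#}, \<mu>) \<in> od_eu_data n" "(t, {#}, \<nu>) \<in> od_eu_data n" "s \<in># \<mu>" "t \<in># \<nu>"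
    and "\<mu> - {#s#} = \<nu> - {#t#}"
  shows "s = t \<and> \<mu> = \<nu>"
proof -
  have "s\<^sup>2 + 2 * sum_mset \<mu> = t\<^sup>2 + 2 * sum_mset \<nu>" using assms by (simp add: od_eu_data_def)
  moreover have "sum_mset (\<mu> - {#s#}) = sum_mset (\<nu> - {#t#})" using assms(5) by (rule arg_cong)
  ultimately have "s\<^sup>2 + 2 * s = t\<^sup>2 + 2 * t"
    using remove1_sum_mset[OF assms(3)] remove1_sum_mset[OF assms(4)] by linarith
  then have "(s + 1)\<^sup>2 = (t + 1)\<^sup>2" by (simp add: power2_eq_square)
  then have "s = t" by (simp add: power2_eq_iff_nonneg)
  then show ?thesis using assms(3,4,5) by (metis insert_DiffM)
qed

lemma card_staircase_odd_le:
  "card {z \<in> od_eu_data (2 * N + 1). 5 \<le> fst z \<and> fst (snd z) = {#} \<and> fst z \<in># snd (snd z)} \<le>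
    card {\<nu> \<in> irregular 3 (N - 4). count \<nu> 1 = 1}" (is "card ?A \<le> card ?R")
proof (rule card_inj_on_le)
  \<comment> \<open>For \<open>s = 2 * r + 1\<close> the rest has total
    \<open>N - 2 * (r^2 + 2 * r) - 1\<close>; the twos fill it up to \<open>N - 4\<close>, and the
    single 1 settles the parity.\<close>
  let ?t = "\<lambda>s. (s div 2)\<^sup>2 + 2 * (s div 2) - (4::nat)"
  let ?f = "\<lambda>z. (snd (snd z) - {#fst z#}) + ({#4, 1#} + replicate_mset (?t (fst z)) 2)"
  have ge: "\<forall>x\<in>#snd (snd z) - {#fst z#}. 5 \<le> x" if "z \<in> ?A" for z
    using that by (cases z) (fastforce simp: od_eu_data_def dest: in_diffD)
  show "inj_on ?f ?A"
  proof (rule inj_onI)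
    fix z z' assume z: "z \<in> ?A" "z' \<in> ?A" and eq: "?f z = ?f z'"
    have *: "{#x \<in># ?f w. 5 \<le> x#} = snd (snd w) - {#fst w#}" if "w \<in> ?A" for w
      by (rule filter_ge_add_small) (use ge[OF that] in \<open>auto split: if_splits\<close>)
    have "snd (snd z) - {#fst z#} = snd (snd z') - {#fst z'#}"
      using *[OF z(1)] *[OF z(2)] eq by metis
    then show "z = z'" using z staircase_inject[of "fst z" "snd (snd z)" _ "fst z'" "snd (snd z')"]
      by (cases z; cases z') auto
  qed
  show "?f ` ?A \<subseteq> ?R"
  proof (rule image_subsetI)
    fix z assume z: "z \<in> ?A"
    obtain s \<mu> where sm: "z = (s, {#}, \<mu>)" using z by (cases z) auto
    have s: "5 \<le> s" "s \<in># \<mu>" and n: "s\<^sup>2 + 2 * sum_mset \<mu> = 2 * N + 1"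
      using z sm by (auto simp: od_eu_data_def)
    define R where "R = \<mu> - {#s#}"
    have R: "\<forall>x\<in>#R. 5 \<le> x" using ge[OF z] sm R_def by simp
    have "odd (s\<^sup>2 + 2 * sum_mset \<mu>)" unfolding n by simp
    then have "odd s" by simp
    then obtain r where r: "s = 2 * r + 1" by (rule oddE)
    have "2 \<le> r" using r s by simp
    then have r4: "8 \<le> r\<^sup>2 + 2 * r" using power_mono[of 2 r 2] by simp
    have "s\<^sup>2 = 4 * r\<^sup>2 + 4 * r + 1" using r by (simp add: power2_eq_square)
    then have "sum_mset R + 2 * (r\<^sup>2 + 2 * r) + 1 = N"
      using n remove1_sum_mset[OF s(2), folded R_def] r by presburger
    moreover define t where "t = r\<^sup>2 + 2 * r - 4"
    ultimately have N: "sum_mset R + 2 * (t + 4) + 1 = N" and t: "?t s = t" "2 \<le> t" using r r4 by simp_all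
    have "1 \<notin># R" using R by auto
    then have "count R 1 = 0" by (simp only: not_in_iff)
    moreover have "\<forall>x\<in>#R. 1 \<le> x" using R by auto
    ultimately have "R + ({#4, 1#} + replicate_mset (?t s) 2) \<in> ?R"
      unfolding t(1) using t(2) N by (auto simp: irregular_def partitions_ge_def split: if_splits)
    then show "?f z \<in> ?R" using sm R_def by simp
  qed
qed (simp add: finite_irregular)

lemma card_staircase_even_le:
  "card {z \<in> od_eu_data (2 * N). 4 \<le> fst z \<and> fst (snd z) = {#} \<and> fst z \<in># snd (snd z)} \<le>
    card {\<nu> \<in> irregular 2 (N - 2). count \<nu> 1 = 0}" (is "card ?A \<le> card ?R")
proof (rule card_inj_on_le)
  \<comment> \<open>For \<open>s = 2 * r\<close> the rest has total
    \<open>N - 2 * (r^2 + r)\<close>. The second 3 settles the parity, as no ones are to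
    occur.\<close>
  let ?t = "\<lambda>s. (s div 2)\<^sup>2 + s div 2 - (4::nat)"
  let ?f = "\<lambda>z. (snd (snd z) - {#fst z#}) + ({#3, 3#} + replicate_mset (?t (fst z)) 2)"
  have ge: "\<forall>x\<in>#snd (snd z) - {#fst z#}. 4 \<le> x" if "z \<in> ?A" for z
    using that by (cases z) (fastforce simp: od_eu_data_def dest: in_diffD)
  show "inj_on ?f ?A"
  proof (rule inj_onI)
    fix z z' assume z: "z \<in> ?A" "z' \<in> ?A" and eq: "?f z = ?f z'"
    have *: "{#x \<in># ?f w. 4 \<le> x#} = snd (snd w) - {#fst w#}" if "w \<in> ?A" for w
      by (rule filter_ge_add_small) (use ge[OF that] in \<open>auto split: if_splits\<close>)
    have "snd (snd z) - {#fst z#} = snd (snd z') - {#fst z'#}"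
      using *[OF z(1)] *[OF z(2)] eq by metis
    then show "z = z'" using z staircase_inject[of "fst z" "snd (snd z)" _ "fst z'" "snd (snd z')"]
      by (cases z; cases z') auto
  qed
  show "?f ` ?A \<subseteq> ?R"
  proof (rule image_subsetI)
    fix z assume z: "z \<in> ?A"
    obtain s \<mu> where sm: "z = (s, {#}, \<mu>)" using z by (cases z) auto
    have s: "4 \<le> s" "s \<in># \<mu>" and n: "s\<^sup>2 + 2 * sum_mset \<mu> = 2 * N"
      using z sm by (auto simp: od_eu_data_def)
    define R where "R = \<mu> - {#s#}"
    have R: "\<forall>x\<in>#R. 4 \<le> x" using ge[OF z] sm R_def by simp
    have "even (s\<^sup>2 + 2 * sum_mset \<mu>)" unfolding n by simp
    then have "even s" by simp
    then obtain r where r: "s = 2 * r" by (rule evenE)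
    have "2 \<le> r" using r s by simp
    then have r4: "6 \<le> r\<^sup>2 + r" using power_mono[of 2 r 2] by simp
    have "s\<^sup>2 = 4 * r\<^sup>2" using r by (simp add: power2_eq_square)
    then have "sum_mset R + 2 * (r\<^sup>2 + r) = N"
      using n remove1_sum_mset[OF s(2), folded R_def] r by presburger
    moreover define t where "t = r\<^sup>2 + r - 4"
    ultimately have N: "sum_mset R + 2 * (t + 4) = N" and t: "?t s = t" "2 \<le> t" using r r4 by simp_all
    have "1 \<notin># R" "2 \<notin># R" using R by auto
    then have "count R 1 = 0" "count R 2 = 0" by (simp_all only: not_in_iff)
    moreover have "\<forall>x\<in>#R. 1 \<le> x" using R by auto
    ultimately have "R + ({#3, 3#} + replicate_mset (?t s) 2) \<in> ?R"
      unfolding t(1) using t(2) N by (auto simp: irregular_def partitions_ge_def split: if_splits)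
    then show "?f z \<in> ?R" using sm R_def by simp
  qed
qed (simp add: finite_irregular)

lemma card_two_data_le:
  "card {z \<in> od_eu_data (2 * N). fst z = 2 \<and> fst (snd z) = {#} \<and> 2 \<in># snd (snd z)} \<le>
    card (partitions_ge 2 (N - 4))" (is "card ?A \<le> card ?R")
proof (rule card_inj_on_le)
  let ?f = "\<lambda>z. snd (snd z) - {#2#}"
  show "inj_on ?f ?A"
  proof (rule inj_onI)
    fix z z' assume z: "z \<in> ?A" "z' \<in> ?A" and "?f z = ?f z'"
    then have "snd (snd z) = snd (snd z')" by (metis (no_types, lifting) insert_DiffM mem_Collect_eq)
    then show "z = z'" using z by (simp add: prod_eq_iff)
  qed
  show "?f ` ?A \<subseteq> ?R"
  proof (rule image_subsetI)
    fix z assume z: "z \<in> ?A"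
    obtain \<mu> where m: "z = (2, {#}, \<mu>)" using z by (cases z) auto
    have "2 \<in># \<mu>" "\<forall>x\<in>#\<mu>. 2 \<le> x" "4 + 2 * sum_mset \<mu> = 2 * N"
      using z m by (auto simp: od_eu_data_def)
    then show "?f z \<in> ?R" using remove1_sum_mset[of 2 \<mu>] m
      by (auto simp: partitions_ge_def dest: in_diffD)
  qed
qed (simp add: finite_partitions_ge)

text \<open>The largest part \<open>y\<close> gives way to 3 and \<open>y - 1\<close> ones. The
  number of ones then bounds all parts; recording this bound leaves an irregular partition over,
  which will make the final inequality strict.\<close>

lemma card_partitions_ge_2_le:
  assumes "10 \<le> N"
  shows "card (partitions_ge 2 (N - 4)) \<le>
    card {\<nu> \<in> irregular 2 (N - 2). 1 \<le> count \<nu> 1 \<and> (\<forall>x\<in>#\<nu>. x \<le> max 3 (count \<nu> 1 + 1))}"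
    (is "card ?A \<le> card ?R")
proof (rule card_inj_on_le)
  let ?M = "\<lambda>\<mu>. \<mu> - {#Max_mset \<mu>#}"
  let ?f = "\<lambda>\<mu>. (?M \<mu> + {#3#}) + replicate_mset (Max_mset \<mu> - 1) 1"
  have pos: "\<mu> \<noteq> {#}" "sum_mset \<mu> = N - 4" "\<forall>x\<in>#?M \<mu>. 2 \<le> x" if "\<mu> \<in> ?A" for \<mu>
    using that assms by (auto simp: partitions_ge_def dest: in_diffD)
  show "inj_on ?f ?A"
  proof (rule inj_onI)
    fix \<mu> \<nu> assume A: "\<mu> \<in> ?A" "\<nu> \<in> ?A" and eq: "?f \<mu> = ?f \<nu>"
    have *: "{#x \<in># ?f \<rho>. 2 \<le> x#} = ?M \<rho> + {#3#}" if "\<rho> \<in> ?A" for \<rho>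
      by (rule filter_ge_add_small) (use pos[OF that] in \<open>auto split: if_splits\<close>)
    have "?M \<mu> + {#3#} = ?M \<nu> + {#3#}" using *[OF A(1)] *[OF A(2)] eq by metis
    then show "\<mu> = \<nu>"
      using remove_Max_inject pos[OF A(1)] pos[OF A(2)] by simp
  qed
  show "?f ` ?A \<subseteq> ?R"
  proof (rule image_subsetI)
    fix \<mu> assume A: "\<mu> \<in> ?A"
    define y R where "y = Max_mset \<mu>" and "R = ?M \<mu>"
    have m: "add_mset y R = \<mu>" using pos[OF A] by (simp add: y_def R_def)
    have "y \<in># \<mu>" unfolding m[symmetric] by simp
    then have y: "2 \<le> y" using A by (auto simp: partitions_ge_def)
    have sm: "sum_mset R + y = N - 4" using arg_cong[OF m, of sum_mset] pos(2)[OF A] by simp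
    have R: "\<forall>x\<in>#R. 2 \<le> x" using pos(3)[OF A] R_def by simp
    have Ry: "x \<le> y" if "x \<in># R" for x
    proof -
      have "x \<in># \<mu>" using that unfolding m[symmetric] by simp
      then show ?thesis unfolding y_def by simp
    qed
    have "1 \<notin># R" using R by auto
    then have c1: "count R 1 = 0" by (simp only: not_in_iff)
    \<comment> \<open>If \<open>y = 2\<close>, only a single one is created, but then all parts are
      2 and, as \<open>N - 4 > 2\<close>, some two remains in \<open>R\<close>.\<close>
    have c2: "2 \<le> (y - 1) + count R 2"
    proof (cases "y = 2")
      case True
      have "R \<noteq> {#}" using sm True assms by auto
      then obtain x where "x \<in># R" by blast
      then have "2 \<in># R" using R Ry[of x] True by (metis le_antisym)
      then show ?thesis using True by (simp add: Suc_le_eq)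
    qed (use y in simp)
    have "\<forall>x\<in>#R + {#3#} + replicate_mset (y - 1) 1. 1 \<le> x \<and> x \<le> max 3 y"
    proof
      fix x assume "x \<in># R + {#3#} + replicate_mset (y - 1) 1"
      then have "x \<in># R \<or> x = 3 \<or> x = 1" by (auto split: if_splits)
      then show "1 \<le> x \<and> x \<le> max 3 y" using bspec[OF R, of x] Ry[of x] by linarith
    qed
    moreover have "sum_mset (R + {#3#} + replicate_mset (y - 1) 1) = N - 2" using sm y assms by simp
    moreover have "\<forall>x\<in>#R. x \<le> Suc (max 2 (y - Suc 0))" using Ry y by fastforce
    ultimately show "?f \<mu> \<in> ?R"
      unfolding R_def[symmetric] unfolding y_def[symmetric] irregular_def partitions_ge_def
      using c1 c2 y by simp
  qed
qed (simp add: finite_irregular)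

section \<open>The comparison\<close>

lemma card_od_eu_data_less_even:
  assumes "14 \<le> N"
  shows "card (od_eu_data (2 * N)) < card (square_data (2 * N))"
proof -
  let ?n = "2 * N" and ?I = "irregular 2 (N - 2)"
  let ?D2 = "{z \<in> od_eu_data ?n. fst z = 2 \<and> fst (snd z) = {#} \<and> 2 \<in># snd (snd z)}"
  let ?D4 = "{z \<in> od_eu_data ?n. 4 \<le> fst z \<and> fst (snd z) = {#} \<and> fst z \<in># snd (snd z)}"
  let ?R2 = "{\<nu> \<in> ?I. 1 \<le> count \<nu> 1 \<and> (\<forall>x\<in>#\<nu>. x \<le> max 3 (count \<nu> 1 + 1))}"
  let ?R4 = "{\<nu> \<in> ?I. count \<nu> 1 = 0}"
  \<comment> \<open>The partition left over: having a single 1, it could lie in \<open>?R2\<close>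
    only with all parts at most 3, but \<open>N - 8 \<ge> 6\<close>.\<close>
  let ?x = "{#1, 2, 3, N - 8#}"
  have "od_eu_data ?n \<subseteq> od_eu_regular ?n \<union> ?D2 \<union> ?D4"
  proof
    fix z assume z: "z \<in> od_eu_data ?n"
    obtain s K \<mu> where 1: "z = (s, K, \<mu>)" by (cases z)
    have "even (s\<^sup>2 + 2 * (sum_mset K + sum_mset \<mu>))" using z 1 by (simp add: od_eu_data_def)
    then have "even s" by simp
    moreover have "K = {#}" if "s = 0"
      using z 1 that by (cases K) (auto simp: od_eu_data_def)
    moreover have "s = 0 \<or> s = 1 \<or> s = 2 \<or> s = 3 \<or> 4 \<le> s" by arith
    ultimately show "z \<in> od_eu_regular ?n \<union> ?D2 \<union> ?D4"
      using z 1 by (auto simp: od_eu_regular_def)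
  qed
  then have "card (od_eu_data ?n) \<le> card (od_eu_regular ?n \<union> ?D2 \<union> ?D4)"
    by (rule card_mono[rotated]) (auto intro: finite_subset[OF _ finite_od_eu_data[of ?n]] simp: od_eu_regular_def)
  also have "\<dots> \<le> card (od_eu_regular ?n) + card ?D2 + card ?D4"
    by (meson add_mono card_Un_le le_refl order_trans)
  also have "\<dots> \<le> card (regular ?n) + card ?R2 + card ?R4"
    using card_od_eu_regular_le[of ?n] card_two_data_le[of N] card_partitions_ge_2_le[of N] assms
      card_staircase_even_le[of N] by linarith
  also have "\<dots> < card (regular ?n) + card ?I"
  proof -
    have x: "?x \<in> ?I" using assms by (auto simp: irregular_def partitions_ge_def)
    have "?x \<notin> ?R2" "?x \<notin> ?R4" using assms by auto
    then have "insert ?x (?R2 \<union> ?R4) \<subseteq> ?I" "?x \<notin> ?R2 \<union> ?R4" "?R2 \<inter> ?R4 = {}"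
      using x by (auto simp: count_eq_zero_iff)
    moreover have "finite ?R2" "finite ?R4" by (simp_all add: finite_irregular)
    ultimately have "Suc (card ?R2 + card ?R4) \<le> card ?I"
      using card_mono[OF finite_irregular, of "insert ?x (?R2 \<union> ?R4)" 2 "N - 2"]
      by (simp add: card_Un_disjoint)
    then show ?thesis by simp
  qed
  also have "\<dots> = card (regular ?n \<union> Pair 2 ` ?I)"
  proof -
    have "regular ?n \<inter> Pair 2 ` ?I = {}" using regular_irregular_disjoint[of 2] by auto
    moreover have "finite (regular ?n)"
      by (rule finite_subset[OF _ finite_square_data[of ?n]]) (auto simp: regular_def)
    moreover have "card (Pair j ` X) = card X" for j :: nat and X :: "nat multiset set"
      by (rule card_image) (simp add: inj_on_def)
    ultimately show ?thesis
      using finite_irregular by (simp add: card_Un_disjoint)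
  qed
  also have "\<dots> \<le> card (square_data ?n)"
    by (rule card_mono[OF finite_square_data])
      (use irregular_square_data[of _ 2 "N - 2" ?n] assms in \<open>auto simp: regular_def\<close>)
  finally show ?thesis .
qed

lemma card_od_eu_data_less_odd:
  assumes N: "186 \<le> N"
  shows "card (od_eu_data (2 * N + 1)) < card (square_data (2 * N + 1))"
proof -
  \<comment> \<open>The totals come from
    \<open>3^2 + 2 * (N - 4) = 5^2 + 2 * (N - 12) = 2 * N + 1\<close>.\<close>
  let ?n = "2 * N + 1" and ?I = "irregular 3 (N - 4)" and ?J = "irregular 5 (N - 12)"
  let ?D1 = "{z \<in> od_eu_data ?n. fst z = 1 \<and> size (fst (snd z)) = 1}"
  let ?D2 = "{z \<in> od_eu_data ?n. fst z = 1 \<and> size (fst (snd z)) = 2}"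
  let ?D3 = "{z \<in> od_eu_data ?n. fst z = 1 \<and> 3 \<le> size (fst (snd z))}"
  let ?E3 = "{z \<in> od_eu_data ?n. fst z = 3 \<and> fst (snd z) = {#} \<and> 3 \<in># snd (snd z)}"
  let ?E5 = "{z \<in> od_eu_data ?n. 5 \<le> fst z \<and> fst (snd z) = {#} \<and> fst z \<in># snd (snd z)}"
  \<comment> \<open>Numbers of ones and twos separate the images: \<open>?A\<close> receives
    \<open>?D3\<close>, \<open>?B\<close> receives \<open>?D2\<close>, \<open>?E\<close> receives
    \<open>?E5\<close> and \<open>?G\<close> receives \<open>?E3\<close>, while \<open>?D1\<close>
    is split among \<open>?C\<close>, \<open>?D\<close> and \<open>?F\<close>.\<close>
  let ?A = "{\<nu> \<in> ?I. 9 \<le> count \<nu> 1 \<and> count \<nu> 2 \<le> 1}"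
  let ?B = "{\<nu> \<in> ?I. 9 \<le> count \<nu> 1 \<and> 2 \<le> count \<nu> 2}"
  let ?C = "{\<nu> \<in> ?I. count \<nu> 1 = 3}"
  let ?D = "{\<nu> \<in> ?I. 4 \<le> count \<nu> 1 \<and> count \<nu> 1 \<le> 8}"
  let ?E = "{\<nu> \<in> ?I. count \<nu> 1 = 1}"
  let ?F = "{\<nu> \<in> ?J. count \<nu> 2 \<le> 4}"
  let ?G = "{\<nu> \<in> ?J. 5 \<le> count \<nu> 2}"
  \<comment> \<open>It has exactly two ones, a number that none of the classes inside
    \<open>?I\<close> allows; hence the strict inequality.\<close>
  let ?x = "{#4, 1, 1, N - 10#}"
  let ?U = "od_eu_regular ?n \<union> ?D1 \<union> ?D2 \<union> ?D3 \<union> ?E3 \<union> ?E5"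
  have "od_eu_data ?n \<subseteq> ?U"
  proof
    fix z assume z: "z \<in> od_eu_data ?n"
    obtain s K \<mu> where 1: "z = (s, K, \<mu>)" by (cases z)
    have n: "s\<^sup>2 + 2 * (sum_mset K + sum_mset \<mu>) = ?n" using z 1 by (simp add: od_eu_data_def)
    have "odd (s\<^sup>2 + 2 * (sum_mset K + sum_mset \<mu>))" unfolding n by simp
    then have "odd s" by simp
    then have "s = 1 \<or> s = 3 \<or> 5 \<le> s" by presburger
    then consider "s = 1" | "s = 3" | "5 \<le> s" by blast
    then show "z \<in> ?U"
    proof cases
      case 1
      have "K = {#} \<or> size K = 1 \<or> size K = 2 \<or> 3 \<le> size K"
        unfolding size_eq_0_iff_empty[symmetric] by arith
      then show ?thesis using z \<open>z = (s, K, \<mu>)\<close> 1 by (auto simp: od_eu_regular_def)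
    qed (use z 1 in \<open>auto simp: od_eu_regular_def\<close>)
  qed
  then have "card (od_eu_data ?n) \<le> card ?U"
    by (rule card_mono[rotated]) (auto intro: finite_subset[OF _ finite_od_eu_data[of ?n]] simp: od_eu_regular_def)
  also have "\<dots> \<le> card (od_eu_regular ?n) + card ?D1 + card ?D2 + card ?D3 + card ?E3 + card ?E5"
    by (meson add_mono card_Un_le le_refl order_trans)
  also have "\<dots> \<le> card (regular ?n) + (card ?C + card ?D + card ?F) + card ?B + card ?A + card ?G + card ?E"
  proof -
    let ?P = "partitions_ge 2 (N - 1)"
    let ?P1 = "{\<mu> \<in> ?P. 5 \<le> count \<mu> 2}"
    let ?P2 = "{\<mu> \<in> ?P. count \<mu> 2 \<le> 4 \<and> 11 \<le> size \<mu>}"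
    let ?P3 = "{\<mu> \<in> ?P. count \<mu> 2 \<le> 4 \<and> size \<mu> \<le> 10}"
    have "?P = ?P1 \<union> ?P2 \<union> ?P3" by auto
    then have "card ?P \<le> card ?P1 + card ?P2 + card ?P3"
      by (metis (no_types, lifting) add_mono card_Un_le le_refl order_trans)
    moreover have "card ?D1 \<le> card ?P" "card ?D2 \<le> card (partitions_ge 3 (N - 2))"
      using card_one_data_size_le[of N 1] card_one_data_size_le[of N 2]
      by (simp_all add: numeral_2_eq_2 numeral_3_eq_3)
    ultimately show ?thesis
      using card_od_eu_regular_le[of ?n] card_many_twos_le[OF N] card_few_twos_long_le[OF N]
        card_few_twos_short_le[OF N] card_partitions_ge_3_le[OF N] card_one_data_large_le[of N]
        card_unique_smallest_le[OF N] card_three_data_le[of N] card_containing_3_le[OF N]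
        card_staircase_odd_le[of N] by linarith
  qed
  also have "\<dots> < card (regular ?n) + card ?I + card ?J"
  proof -
    have x: "?x \<in> ?I" "count ?x 1 = 2" using N by (auto simp: irregular_def partitions_ge_def)
    have fin: "finite ?I" "finite ?J" by (rule finite_irregular)+
    have add: "card X + card Y = card (X \<union> Y)" if "X \<subseteq> ?I" "Y \<subseteq> ?I" "X \<inter> Y = {}" for X Y
      using card_Un_disjoint finite_subset[OF _ fin(1)] that by metis
    have "card ?A + card ?B = card (?A \<union> ?B)" by (rule add) auto
    moreover have "card (?A \<union> ?B) + card ?C = card (?A \<union> ?B \<union> ?C)" by (rule add) auto
    moreover have "card (?A \<union> ?B \<union> ?C) + card ?D = card (?A \<union> ?B \<union> ?C \<union> ?D)" by (rule add) auto
    moreover have "card (?A \<union> ?B \<union> ?C \<union> ?D) + card ?E = card (?A \<union> ?B \<union> ?C \<union> ?D \<union> ?E)"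
      by (rule add) auto
    moreover have "card (?A \<union> ?B \<union> ?C \<union> ?D \<union> ?E) + card {?x} = card (?A \<union> ?B \<union> ?C \<union> ?D \<union> ?E \<union> {?x})"
      using x by (intro add) (blast, blast, auto simp del: count_add_mset)
    moreover have "card (?A \<union> ?B \<union> ?C \<union> ?D \<union> ?E \<union> {?x}) \<le> card ?I"
      by (rule card_mono[OF fin(1)]) (use x in blast)
    moreover have "card {?x} = 1" by simp
    ultimately have 1: "card ?A + card ?B + card ?C + card ?D + card ?E + 1 \<le> card ?I" by linarith
    have "card ?F + card ?G = card (?F \<union> ?G)" using fin by (subst card_Un_disjoint) auto
    also have "\<dots> \<le> card ?J" by (rule card_mono[OF fin(2)]) blast
    finally show ?thesis using 1 by linarith
  qed
  also have "\<dots> = card (regular ?n \<union> Pair 3 ` ?I \<union> Pair 5 ` ?J)"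
  proof -
    have "regular ?n \<inter> Pair 3 ` ?I = {}" "(regular ?n \<union> Pair 3 ` ?I) \<inter> Pair 5 ` ?J = {}"
      using regular_irregular_disjoint[of 3] regular_irregular_disjoint[of 5] by auto
    moreover have "finite (regular ?n)"
      by (rule finite_subset[OF _ finite_square_data[of ?n]]) (auto simp: regular_def)
    moreover have "card (Pair j ` X) = card X" for j :: nat and X :: "nat multiset set"
      by (rule card_image) (simp add: inj_on_def)
    ultimately show ?thesis
      using finite_irregular by (simp add: card_Un_disjoint)
  qed
  also have "\<dots> \<le> card (square_data ?n)"
    by (rule card_mono[OF finite_square_data])
      (use irregular_square_data[of _ 3 "N - 4" ?n] irregular_square_data[of _ 5 "N - 12" ?n] N
       in \<open>auto simp: regular_def\<close>)
  finally show ?thesis .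
qed

theorem theorem1p2:
  fixes n :: nat
  assumes "n \<ge> 373"
  shows "p_od_eu n < p_eu_od n"
proof -
  have "card (od_eu_data n) < card (square_data n)"
  proof (cases "even n")
    case True
    then obtain N where "n = 2 * N" by (rule evenE)
    then show ?thesis using card_od_eu_data_less_even[of N] assms by simp
  next
    case False
    then obtain N where "n = 2 * N + 1" by (rule oddE)
    \<comment> \<open>\<open>2 * N + 1 \<ge> 373\<close> says exactly
      \<open>N \<ge> 186\<close>.\<close>
    then show ?thesis using card_od_eu_data_less_odd[of N] assms by simp
  qed
  then show ?thesis using p_od_eu_le[of n] square_data_le[of n] by linarith
qed

end
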